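(* Let $\mathcal{S} \subseteq \mathbb{S}^n$ be a linear subspace with orthogonal projection map $P_{\mathcal{S}} : \mathbb{S}^n \rightarrow \mathbb{S}^n$. The following statements are equivalent. 1. The projection $P_{\mathcal{S}}$ is positive, i.e., $P_{\mathcal{S}}(\mathbb{S}^n_{+}) \subseteq \mathbb{S}^n_{+}$, and unital, i.e., there exists $E \in \mathcal{S}$ such that $X \circ E = X$ for all $X \in \mathcal{S}$. 2. The subspace $\mathcal{S}$ is a (Jordan) subalgebra of $\mathbb{S}^n$, i.e., $X \circ Y \in \mathcal{S}$ for all $X, Y \in \mathcal{S}$.
   Context: $\mathbb{S}^n$ is the real vector space of real symmetric $n \times n$ matrices with the trace inner product $X \cdot Y := \mathrm{Tr}(XY)$ and the Jordan product $X \circ Y := \frac{1}{2}(XY + YX)$. $\mathbb{S}^n_{+}$ is the cone of positive semidefinite matrices. For a subspace $\mathcal{S} \subseteq \mathbb{S}^n$, $P_{\mathcal{S}}$ is the orthogonal projection onto $\mathcal{S}$ with respect to the trace inner product. The unit $E$ in the unitality condition need not be the identity matrix. *)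

theory Defs
  imports "HOL-Analysis.Analysis"
begin

text \<open>The space of real symmetric matrices is a proper subset of the type
  \<open>real^'n^'n\<close> of all square matrices. Note that the library product \<open>*\<close> on this
  type is entrywise; the matrix product is \<open>**\<close>.\<close>

definition symmetric_matrices :: "(real^'n^'n) set" where
  "symmetric_matrices = {X. transpose X = X}"

definition psd_cone :: "(real^'n^'n) set" where
  "psd_cone = {X \<in> symmetric_matrices. \<forall>v. 0 \<le> v \<bullet> (X *v v)}"

definition trace_inner :: "real^'n^'n \<Rightarrow> real^'n^'n \<Rightarrow> real" where
  "trace_inner X Y = trace (X ** Y)"

definition jordan_prod :: "real^'n^'n \<Rightarrow> real^'n^'n \<Rightarrow> real^'n^'n" where
  "jordan_prod X Y = (1/2) *\<^sub>R (X ** Y + Y ** X)"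

text \<open>Meaningful when \<open>S\<close> is a subspace of \<open>symmetric_matrices\<close>: on all of
  \<open>real^'n^'n\<close> the form \<open>trace_inner\<close> is indefinite. Existence and uniqueness of the
  projected point are proved below.\<close>

definition orth_proj :: "(real^'n^'n) set \<Rightarrow> real^'n^'n \<Rightarrow> real^'n^'n" where
  "orth_proj S X = (THE Y. Y \<in> S \<and> (\<forall>Z\<in>S. trace_inner (X - Y) Z = 0))"

definition positive_map :: "(real^'n^'n \<Rightarrow> real^'n^'n) \<Rightarrow> bool" where
  "positive_map P \<longleftrightarrow> P ` psd_cone \<subseteq> psd_cone"

text \<open>The unit need not be the identity matrix.\<close>

definition has_jordan_unit :: "(real^'n^'n) set \<Rightarrow> bool" where
  "has_jordan_unit S \<longleftrightarrow> (\<exists>E\<in>S. \<forall>X\<in>S. jordan_prod X E = X)"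

definition jordan_subalgebra :: "(real^'n^'n) set \<Rightarrow> bool" where
  "jordan_subalgebra S \<longleftrightarrow>
     subspace S \<and> S \<subseteq> symmetric_matrices \<and> (\<forall>X\<in>S. \<forall>Y\<in>S. jordan_prod X Y \<in> S)"

lemma trace_inner_eq_inner:
  fixes X Z :: "real^'n^'n"
  assumes "Z \<in> symmetric_matrices"
  shows "trace_inner X Z = X \<bullet> Z"
proof -
  have "Z $ j $ i = Z $ i $ j" for i j
    using assms by (auto simp: symmetric_matrices_def transpose_def vec_eq_iff)
  then show ?thesis
    by (simp add: trace_inner_def trace_def matrix_matrix_mult_def inner_vec_def)
qed

lemma orth_proj_ex1:
  fixes S :: "(real^'n^'n) set"
  assumes "subspace S" "S \<subseteq> symmetric_matrices"
  shows "\<exists>!Y. Y \<in> S \<and> (\<forall>Z\<in>S. trace_inner (X - Y) Z = 0)"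
proof -
  have eq: "(\<forall>Z\<in>S. trace_inner (X - Y) Z = 0) \<longleftrightarrow> (\<forall>Z\<in>S. (X - Y) \<bullet> Z = 0)" for Y
    using assms(2) trace_inner_eq_inner by (metis subsetD)
  have sp: "span S = S"
    using assms(1) by (simp add: span_eq_iff)
  obtain Y Z where YZ: "Y \<in> S" "\<And>w. w \<in> S \<Longrightarrow> orthogonal Z w" "X = Y + Z"
    using orthogonal_subspace_decomp_exists[of S X] unfolding sp by metis
  show ?thesis
    unfolding eq
  proof (rule ex1I[of _ Y])
    show "Y \<in> S \<and> (\<forall>Z\<in>S. (X - Y) \<bullet> Z = 0)"
      using YZ by (auto simp: orthogonal_def)
  next
    fix W assume W: "W \<in> S \<and> (\<forall>Z\<in>S. (X - W) \<bullet> Z = 0)"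
    have D: "Y - W \<in> S"
      using W YZ(1) assms(1) by (simp add: subspace_diff)
    have "(X - W) \<bullet> (Y - W) = 0" "Z \<bullet> (Y - W) = 0"
      using W D YZ(2) by (auto simp: orthogonal_def)
    then have "(Y - W) \<bullet> (Y - W) = 0"
      using YZ(3) by (simp add: inner_diff_left inner_add_left)
    then show "W = Y" by simp
  qed
qed

lemma orth_proj_works:
  fixes S :: "(real^'n^'n) set"
  assumes "subspace S" "S \<subseteq> symmetric_matrices"
  shows "orth_proj S X \<in> S"
    and "Z \<in> S \<Longrightarrow> trace_inner (X - orth_proj S X) Z = 0"
  using theI'[OF orth_proj_ex1[OF assms, of X]] unfolding orth_proj_def by auto

end

theory Submission
  imports Defs
begin

text \<open>Let \<open>P\<close> be the orthogonal projection onto \<open>S\<close>.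

  If \<open>P\<close> is positive with unit \<open>E\<close>, then \<open>E\<close> is a projection with \<open>E X = X E = X\<close> on \<open>S\<close>, so
  \<open>P(I) = E\<close>. Applying \<open>P\<close> to the spectral resolution of \<open>X \<in> S\<close> gives Kadison's inequality
  \<open>P(X\<^sup>2) \<ge> X\<^sup>2\<close>; both sides have the same trace, hence \<open>X\<^sup>2 = P(X\<^sup>2) \<in> S\<close>, and polarisation shows
  that \<open>S\<close> is a Jordan algebra.

  Conversely, a Jordan algebra contains \<open>h(Y)\<close> for all its members \<open>Y\<close> and all \<open>h\<close> with
  \<open>h(0) = 0\<close>. If \<open>P(X)\<close> had an eigenvalue \<open>c < 0\<close> for a positive semidefinite \<open>X\<close>, its spectral
  projection \<open>Q \<in> S\<close> would satisfy \<open>0 > P(X) \<cdot> Q = X \<cdot> Q \<ge> 0\<close>. The unit is the projection onto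
  the range of \<open>\<Sum>\<^sub>b b\<^sup>2\<close>, with \<open>b\<close> ranging over a basis of \<open>S\<close>.\<close>

section \<open>The spectral theorem\<close>

lemma symmetric_matrices_inner:
  fixes A :: "real^'n^'n"
  assumes "A \<in> symmetric_matrices"
  shows "v \<bullet> (A *v w) = (A *v v) \<bullet> w"
  using assms dot_lmul_matrix[of v A w]
  by (simp add: symmetric_matrices_def flip: vector_transpose_matrix)

text \<open>A maximiser of the quadratic form on the unit sphere of \<open>U\<close> is an
  eigenvector. Invariance keeps the residual \<open>w\<close> inside \<open>U\<close>, so that
  \<open>v\<close> may be varied in that direction.\<close>

lemma symmetric_eigenvector:
  fixes A :: "real^'n^'n"
  assumes A: "A \<in> symmetric_matrices" and U: "subspace U" and inv: "\<And>x. x \<in> U \<Longrightarrow> A *v x \<in> U"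
    and "u \<in> U" "u \<noteq> 0"
  obtains v c where "v \<in> U" "norm v = 1" "A *v v = c *\<^sub>R v"
proof -
  let ?K = "sphere 0 1 \<inter> U"
  have "compact ?K"
    using closed_subspace[OF U] by (intro compact_Int_closed) auto
  moreover have "u /\<^sub>R norm u \<in> ?K"
    using assms by (simp add: subspace_scale)
  moreover have "continuous_on ?K (\<lambda>x. x \<bullet> (A *v x))"
    by (intro continuous_intros linear_continuous_on) (simp add: linear_linear)
  ultimately obtain v where v: "v \<in> ?K" and max: "\<And>x. x \<in> ?K \<Longrightarrow> x \<bullet> (A *v x) \<le> v \<bullet> (A *v v)"
    using continuous_attains_sup[of ?K] by blast
  define c where "c = v \<bullet> (A *v v)"
  have le: "x \<bullet> (A *v x) \<le> c * (x \<bullet> x)" if "x \<in> U" for x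
  proof (cases "x = 0")
    case False
    then have "x /\<^sub>R norm x \<in> ?K"
      using that U by (simp add: subspace_scale)
    from max[OF this] False show ?thesis
      by (simp add: c_def matrix_vector_mult_scaleR field_simps dot_square_norm power2_eq_square)
  qed simp
  define w where "w = A *v v - c *\<^sub>R v"
  have vv: "v \<bullet> v = 1"
    using v by (simp add: dot_square_norm)
  have "w \<in> U"
    using v inv U by (simp add: w_def subspace_diff subspace_scale)
  have vw: "v \<bullet> w = 0" "w \<bullet> v = 0"
    using vv by (simp_all add: w_def c_def inner_diff_right inner_diff_left inner_commute)
  have wAv: "w \<bullet> (A *v v) = w \<bullet> w"
    using vw by (simp add: w_def inner_diff_right)
  then have vAw: "v \<bullet> (A *v w) = w \<bullet> w"
    using symmetric_matrices_inner[OF A, of v w] by (simp add: inner_commute)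
  define n where "n = w \<bullet> w"
  define d where "d = c * n - w \<bullet> (A *v w)"
  \<comment> \<open>Insert \<open>v + t *\<^sub>R w\<close> into \<open>le\<close>: the constant
    terms cancel, and both mixed terms equal \<open>t * n\<close>. For small positive
    \<open>t\<close> the linear term wins unless \<open>n = 0\<close>.\<close>
  have quad: "2 * t * n \<le> t\<^sup>2 * d" for t
  proof -
    have "v + t *\<^sub>R w \<in> U"
      using v \<open>w \<in> U\<close> U by (simp add: subspace_add subspace_scale)
    from le[OF this] show ?thesis
      using vw wAv vAw vv
      by (simp add: n_def d_def matrix_vector_mult_scaleR matrix_vector_right_distrib
          inner_add_left inner_add_right c_def[symmetric] algebra_simps power2_eq_square)
  qed
  have "n = 0"
  proof (rule ccontr)
    assume "n \<noteq> 0"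
    then have "n > 0" by (simp add: n_def)
    \<comment> \<open>A positive number above \<open>d\<close>, so that \<open>t = n / k\<close> is
      small enough to contradict \<open>quad\<close>.\<close>
    define k where "k = \<bar>d\<bar> + 1"
    have "k > 0" "d < k" by (simp_all add: k_def)
    have "2 * (n / k) * n \<le> (n / k)\<^sup>2 * d" by (rule quad)
    also have "\<dots> \<le> (n / k)\<^sup>2 * k" using \<open>d < k\<close> by (simp add: mult_left_mono)
    also have "\<dots> = (n / k) * n" using \<open>k > 0\<close> by (simp add: power2_eq_square)
    finally have "(n / k) * n \<le> 0" by simp
    then show False
      using \<open>n > 0\<close> \<open>k > 0\<close> by (simp add: divide_le_0_iff mult_le_0_iff)
  qed
  then have "A *v v = c *\<^sub>R v"
    by (simp add: n_def w_def)
  with v show thesis by (intro that) auto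
qed

section \<open>Orthonormal eigenbases\<close>

definition orthonormal :: "'a::real_inner set \<Rightarrow> bool" where
  "orthonormal B \<longleftrightarrow> finite B \<and> (\<forall>b\<in>B. \<forall>c\<in>B. b \<bullet> c = (if b = c then 1 else 0))"

lemma orthonormal_card_le:
  fixes B :: "'a::euclidean_space set"
  assumes "orthonormal B"
  shows "card B \<le> DIM('a)"
proof -
  have "pairwise orthogonal B"
    using assms by (auto simp: orthonormal_def pairwise_def orthogonal_def)
  moreover have "0 \<notin> B"
  proof
    assume "0 \<in> B"
    with assms have "(0::'a) \<bullet> 0 = 1" unfolding orthonormal_def by metis
    then show False by simp
  qed
  ultimately show ?thesis
    using pairwise_orthogonal_independent independent_card_le by blast
qed

text \<open>Take an orthonormal set of eigenvectors of greatest cardinality. Its orthogonal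
  complement \<open>U\<close> is invariant under \<open>A\<close>, so a nonzero \<open>U\<close>
  would supply one more eigenvector.\<close>

lemma symmetric_eigenbasis:
  fixes A :: "real^'n^'n"
  assumes A: "A \<in> symmetric_matrices"
  obtains B l where "orthonormal B" "\<And>b. b \<in> B \<Longrightarrow> A *v b = l b *\<^sub>R b"
    "\<And>x. (\<Sum>b\<in>B. (b \<bullet> x) *\<^sub>R b) = x"
proof -
  let ?P = "\<lambda>B. orthonormal B \<and> (\<forall>b\<in>B. \<exists>c. A *v b = c *\<^sub>R b)"
  have "?P {}" by (simp add: orthonormal_def)
  moreover have "\<forall>B. ?P B \<longrightarrow> card B < Suc DIM(real^'n)"
    using orthonormal_card_le[where ?'a = "real^'n"] by (auto simp del: DIM_cart simp: less_Suc_eq_le)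
  ultimately have "\<exists>B. ?P B \<and> (\<forall>C. ?P C \<longrightarrow> card C \<le> card B)"
    by (rule Lattices_Big.ex_has_greatest_nat[where P = ?P])
  then obtain B where B: "?P B" and max: "\<And>C. ?P C \<Longrightarrow> card C \<le> card B"
    by metis
  have fin: "finite B" and orth: "\<And>b c. b \<in> B \<Longrightarrow> c \<in> B \<Longrightarrow> b \<bullet> c = (if b = c then 1 else 0)"
    using B by (auto simp: orthonormal_def)
  from B obtain l where l: "\<And>b. b \<in> B \<Longrightarrow> A *v b = l b *\<^sub>R b"
    by metis
  define U where "U = {x. \<forall>b\<in>B. b \<bullet> x = 0}"
  have U: "subspace U"
    by (auto simp: U_def subspace_def inner_add_right)
  have inv: "A *v x \<in> U" if "x \<in> U" for x
    using that l symmetric_matrices_inner[OF A] by (simp add: U_def)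
  have "U \<subseteq> {0}"
  proof
    fix u assume "u \<in> U"
    show "u \<in> {0}"
    proof (rule ccontr)
      assume "u \<notin> {0}"
      then obtain v c where v: "v \<in> U" "norm v = 1" "A *v v = c *\<^sub>R v"
        using symmetric_eigenvector[OF A U inv \<open>u \<in> U\<close>] by blast
      then have "v \<bullet> v = 1" by (simp add: dot_square_norm)
      then have "v \<notin> B" using v by (auto simp: U_def)
      moreover have "?P (insert v B)"
        using B v \<open>v \<bullet> v = 1\<close> \<open>v \<notin> B\<close> by (auto simp: orthonormal_def U_def inner_commute)
      ultimately show False
        using max[of "insert v B"] fin by simp
    qed
  qed
  have "(\<Sum>b\<in>B. (b \<bullet> x) *\<^sub>R b) = x" for x
  proof -
    have "x - (\<Sum>b\<in>B. (b \<bullet> x) *\<^sub>R b) \<in> U"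
      using fin by (auto simp: U_def inner_diff_right inner_sum_right orth if_distrib sum.delta cong: if_cong)
    with \<open>U \<subseteq> {0}\<close> show ?thesis by auto
  qed
  with B l show thesis by (intro that) auto
qed

section \<open>Matrices diagonal in an orthonormal set\<close>

definition outer :: "real^'n \<Rightarrow> real^'n^'n" where
  "outer b = (\<chi> i j. b $ i * b $ j)"

text \<open>For orthonormal \<open>B\<close>, this is the matrix with eigenvalue \<open>f b\<close>
  at \<open>b\<close> that vanishes on the orthogonal complement of \<open>B\<close>. Matrix algebra
  becomes pointwise algebra of eigenvalue functions.\<close>

definition diag_op :: "(real^'n) set \<Rightarrow> (real^'n \<Rightarrow> real) \<Rightarrow> real^'n^'n" where
  "diag_op B f = (\<Sum>b\<in>B. f b *\<^sub>R outer b)"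

lemma outer_mult_vec: "outer b *v x = (b \<bullet> x) *\<^sub>R b"
  by (simp add: outer_def vec_eq_iff matrix_vector_mult_def inner_vec_def sum_distrib_left sum_distrib_right mult_ac)

lemma inner_outer: "X \<bullet> outer b = b \<bullet> (X *v b)"
  by (simp add: outer_def inner_vec_def matrix_vector_mult_def sum_distrib_left sum_distrib_right mult_ac)

lemma outer_psd: "outer b \<in> psd_cone"
proof -
  have "outer b \<in> symmetric_matrices"
    by (simp add: outer_def symmetric_matrices_def transpose_def vec_eq_iff mult.commute)
  then show ?thesis
    by (simp add: psd_cone_def outer_mult_vec inner_commute)
qed

lemma sum_matrix_vector_mult: "(\<Sum>i\<in>I. F i) *v x = (\<Sum>i\<in>I. F i *v (x :: real^'n))"
  by (induction I rule: infinite_finite_induct) (auto simp: matrix_vector_mult_add_rdistrib)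

lemma diag_op_mult_vec: "diag_op B f *v x = (\<Sum>b\<in>B. (f b * (b \<bullet> x)) *\<^sub>R b)"
  by (simp add: diag_op_def sum_matrix_vector_mult outer_mult_vec flip: scaleR_matrix_vector_assoc)

lemma inner_diag_op: "X \<bullet> diag_op B f = (\<Sum>b\<in>B. f b * (b \<bullet> (X *v b)))"
  by (simp add: diag_op_def inner_sum_right inner_outer)

lemma diag_op_mult_basis:
  assumes "orthonormal B" "b \<in> B"
  shows "diag_op B f *v b = f b *\<^sub>R b"
proof -
  have "diag_op B f *v b = (\<Sum>c\<in>B. if c = b then f b *\<^sub>R b else 0)"
    unfolding diag_op_mult_vec
    by (rule sum.cong) (use assms in \<open>auto simp: orthonormal_def\<close>)
  with assms show ?thesis by (simp add: orthonormal_def)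
qed

lemma diag_op_mult:
  assumes "orthonormal B"
  shows "diag_op B f ** diag_op B g = diag_op B (\<lambda>b. f b * g b)"
proof -
  have "diag_op B f *v (diag_op B g *v x) = diag_op B (\<lambda>b. f b * g b) *v x" for x
  proof -
    have "diag_op B f *v (diag_op B g *v x) = (\<Sum>b\<in>B. (g b * (b \<bullet> x)) *\<^sub>R (diag_op B f *v b))"
      by (simp add: diag_op_mult_vec[of B g] matrix_vector_mult_scaleR linear_sum)
    also have "\<dots> = diag_op B (\<lambda>b. f b * g b) *v x"
      unfolding diag_op_mult_vec[of B "\<lambda>b. f b * g b"]
      by (rule sum.cong) (use assms in \<open>simp_all add: diag_op_mult_basis mult_ac\<close>)
    finally show ?thesis .
  qed
  then show ?thesis
    by (simp add: matrix_eq matrix_vector_mul_assoc)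
qed

lemma diag_op_add: "diag_op B (\<lambda>b. f b + g b) = diag_op B f + diag_op B g"
  by (simp add: diag_op_def scaleR_left_distrib sum.distrib)

lemma diag_op_scale: "diag_op B (\<lambda>b. c * f b) = c *\<^sub>R diag_op B f"
  by (simp add: diag_op_def scaleR_sum_right)

lemma diag_op_cong: "(\<And>b. b \<in> B \<Longrightarrow> f b = g b) \<Longrightarrow> diag_op B f = diag_op B g"
  by (simp add: diag_op_def)

text \<open>The equation for \<open>mat 1\<close> records that \<open>B\<close> is a full
  orthonormal basis.\<close>

lemma symmetric_spectral:
  fixes A :: "real^'n^'n"
  assumes "A \<in> symmetric_matrices"
  obtains B l where "orthonormal B" "A = diag_op B l" "mat 1 = diag_op B (\<lambda>_. 1)"
proof -
  obtain B l where B: "orthonormal B" "\<And>b. b \<in> B \<Longrightarrow> A *v b = l b *\<^sub>R b"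
    and expand: "\<And>x. (\<Sum>b\<in>B. (b \<bullet> x) *\<^sub>R b) = x"
    using symmetric_eigenbasis[OF assms] by blast
  have "A *v x = diag_op B l *v x" for x
  proof -
    have "A *v x = A *v (\<Sum>b\<in>B. (b \<bullet> x) *\<^sub>R b)"
      by (simp only: expand)
    also have "\<dots> = (\<Sum>b\<in>B. (b \<bullet> x) *\<^sub>R (A *v b))"
      by (simp add: matrix_vector_mult_scaleR linear_sum)
    finally show ?thesis
      by (simp add: diag_op_mult_vec B(2) mult_ac)
  qed
  then have "A = diag_op B l" by (simp add: matrix_eq)
  moreover have "mat 1 = diag_op B (\<lambda>_. 1)"
    by (simp add: matrix_eq diag_op_mult_vec expand)
  ultimately show thesis
    using B that by blast
qed

section \<open>Functional calculus in a Jordan subalgebra\<close>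

text \<open>There are finitely many eigenvalues, so the claim reduces to spectral projections, which
  are Lagrange polynomials in the matrix. Since the identity may lie outside \<open>S\<close>, only
  polynomials without constant term are available; hence \<open>h 0 = 0\<close>.\<close>

lemma jordan_subalgebra_diag_op:
  assumes S: "jordan_subalgebra S" and B: "orthonormal B" and l: "diag_op B l \<in> S" and "h 0 = 0"
  shows "diag_op B (\<lambda>b. h (l b)) \<in> S"
proof -
  have sub: "subspace S" using S by (simp add: jordan_subalgebra_def)
  \<comment> \<open>Both matrices are diagonal in \<open>B\<close> and commute, so their Jordan
    product is the matrix product.\<close>
  have mult: "diag_op B (\<lambda>b. f b * g b) \<in> S" if "diag_op B f \<in> S" "diag_op B g \<in> S" for f g
  proof -
    have "jordan_prod (diag_op B f) (diag_op B g) = diag_op B (\<lambda>b. f b * g b)"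
      by (simp add: jordan_prod_def diag_op_mult[OF B] mult.commute flip: scaleR_2)
    with that S show ?thesis by (metis jordan_subalgebra_def)
  qed
  \<comment> \<open>The leading factor \<open>l b\<close> removes the constant term, so each further
    factor \<open>l b - s\<close> can be expanded within \<open>S\<close>.\<close>
  have prod: "diag_op B (\<lambda>b. l b * (\<Prod>t\<in>T. l b - t)) \<in> S" if "finite T" for T
    using that
  proof induction
    case (insert s T)
    let ?f = "\<lambda>b. l b * (\<Prod>t\<in>T. l b - t)"
    have "diag_op B (\<lambda>b. ?f b * l b + (- s) * ?f b) \<in> S"
      unfolding diag_op_add diag_op_scale
      by (intro subspace_add[OF sub] subspace_scale[OF sub] mult insert.IH l)
    moreover have "(\<lambda>b. ?f b * l b + (- s) * ?f b) = (\<lambda>b. l b * (\<Prod>t\<in>insert s T. l b - t))"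
      using insert.hyps by (simp add: algebra_simps)
    ultimately show ?case by simp
  qed (simp add: l)
  have fin: "finite (l ` B)" using B by (simp add: orthonormal_def)
  have ind: "diag_op B (\<lambda>b. if l b = c then 1 else 0) \<in> S" if "c \<noteq> 0" for c
  proof -
    define T where "T = l ` B - {c}"
    \<comment> \<open>The value at \<open>c\<close> of the interpolation polynomial that vanishes at
      all other eigenvalues; dividing by it normalises the polynomial.\<close>
    define k where "k = c * (\<Prod>t\<in>T. c - t)"
    have "finite T" using fin by (simp add: T_def)
    then have "k \<noteq> 0" using that by (auto simp: k_def T_def)
    have "diag_op B (\<lambda>b. inverse k * (l b * (\<Prod>t\<in>T. l b - t))) \<in> S"
      unfolding diag_op_scale by (intro subspace_scale[OF sub] prod \<open>finite T\<close>)
    moreover have "inverse k * (l b * (\<Prod>t\<in>T. l b - t)) = (if l b = c then 1 else 0)" if "b \<in> B" for b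
    proof (cases "l b = c")
      case True
      then have "l b * (\<Prod>t\<in>T. l b - t) = k" by (simp add: k_def)
      with \<open>k \<noteq> 0\<close> True show ?thesis by simp
    next
      case False
      with that have "l b \<in> T" by (simp add: T_def)
      with \<open>finite T\<close> have "(\<Prod>t\<in>T. l b - t) = 0" by auto
      with False show ?thesis by simp
    qed
    ultimately show ?thesis by (simp cong: diag_op_cong)
  qed
  have sum: "diag_op B (\<lambda>b. \<Sum>c\<in>T. h c * (if l b = c then 1 else 0)) \<in> S" if "finite T" for T
    using that
  proof induction
    case empty
    then show ?case by (simp add: diag_op_def subspace_0[OF sub])
  next
    case (insert s T)
    \<comment> \<open>For \<open>s = 0\<close> the coefficient is zero, so the projection onto the
      kernel never has to be in \<open>S\<close>.\<close>
    have "h s *\<^sub>R diag_op B (\<lambda>b. if l b = s then 1 else 0) \<in> S"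
      using ind[of s] \<open>h 0 = 0\<close>
      by (cases "s = 0") (auto intro: subspace_scale[OF sub] simp: subspace_0[OF sub])
    then show ?case
      using insert by (simp add: diag_op_add diag_op_scale subspace_add[OF sub] del: mult_if_delta)
  qed
  have "(\<Sum>c\<in>l ` B. h c * (if l b = c then 1 else 0)) = h (l b)" if "b \<in> B" for b
    using that fin by (simp add: if_distrib cong: if_cong)
  with sum[OF fin] show ?thesis by (simp cong: diag_op_cong)
qed

section \<open>Positivity of the projection onto a Jordan subalgebra\<close>

lemma psd_diag_op:
  assumes "\<And>b. b \<in> B \<Longrightarrow> 0 \<le> f b" "diag_op B f \<in> symmetric_matrices"
  shows "diag_op B f \<in> psd_cone"
  using assms
  by (auto simp: psd_cone_def diag_op_mult_vec inner_sum_right inner_commute mult.assoc intro!: sum_nonneg)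

lemma inner_orth_proj:
  assumes "subspace S" "S \<subseteq> symmetric_matrices" "Z \<in> S"
  shows "orth_proj S X \<bullet> Z = X \<bullet> Z"
proof -
  have "(X - orth_proj S X) \<bullet> Z = 0"
    using orth_proj_works(2)[OF assms] assms trace_inner_eq_inner by (metis subsetD)
  then show ?thesis by (simp add: inner_diff_left)
qed

lemma jordan_subalgebra_positive_map:
  fixes S :: "(real^'n^'n) set"
  assumes S: "jordan_subalgebra S"
  shows "positive_map (orth_proj S)"
  unfolding positive_map_def
proof (rule image_subsetI)
  fix X :: "real^'n^'n" assume X: "X \<in> psd_cone"
  have S': "subspace S" "S \<subseteq> symmetric_matrices"
    using S by (auto simp: jordan_subalgebra_def)
  let ?Y = "orth_proj S X"
  have Y: "?Y \<in> S" by (rule orth_proj_works(1)[OF S'])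
  then obtain B l where B: "orthonormal B" "?Y = diag_op B l"
    using S' symmetric_spectral by blast
  have "0 \<le> l b" if "b \<in> B" for b
  proof (rule ccontr)
    assume neg: "\<not> 0 \<le> l b"
    \<comment> \<open>The spectral projection of the negative eigenvalue \<open>l b\<close>; as
      \<open>l b\<close> is nonzero, the functional calculus puts it in \<open>S\<close>.\<close>
    let ?p = "\<lambda>a. if l a = l b then 1 else 0 :: real"
    have "diag_op B ?p \<in> S"
      using jordan_subalgebra_diag_op[OF S B(1), of l "\<lambda>t. if t = l b then 1 else 0"] Y B neg by simp
    then have "?Y \<bullet> diag_op B ?p = X \<bullet> diag_op B ?p"
      by (rule inner_orth_proj[OF S'])
    also have "\<dots> \<ge> 0"
      using X by (auto simp: inner_diag_op psd_cone_def intro: sum_nonneg)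
    finally have "0 \<le> (\<Sum>a\<in>B. ?p a * l a)"
      using B(1) by (simp add: inner_diag_op B(2) diag_op_mult_basis orthonormal_def)
    \<comment> \<open>No summand is positive, and the one at \<open>b\<close> is negative.\<close>
    moreover have "(\<Sum>a\<in>B. ?p a * l a) < (\<Sum>a\<in>B. 0)"
      by (rule sum_strict_mono_ex1) (use B(1) neg that in \<open>auto simp: orthonormal_def\<close>)
    ultimately show False by simp
  qed
  then show "?Y \<in> psd_cone"
    using psd_diag_op[of B l] Y B S' by auto
qed

section \<open>The unit of a Jordan subalgebra\<close>

lemma matrix_diff_ldistrib:
  fixes A :: "real^'n^'m"
  shows "A ** (B - C) = A ** B - A ** C"
  by (simp add: matrix_matrix_mult_def vec_eq_iff algebra_simps sum_subtractf)

lemma jordan_subalgebra_unit: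
  assumes S: "jordan_subalgebra S"
  shows "has_jordan_unit S"
proof -
  have S': "subspace S" "S \<subseteq> symmetric_matrices"
    using S by (auto simp: jordan_subalgebra_def)
  obtain D where D: "independent D" "D \<subseteq> S" "S \<subseteq> span D"
    using maximal_independent_subset[of S] by blast
  have finD: "finite D" using D independent_imp_finite by blast
  define X where "X = (\<Sum>d\<in>D. d ** d)"
  have "d ** d \<in> S" if "d \<in> S" for d
  proof -
    have "jordan_prod d d = d ** d"
      by (simp add: jordan_prod_def flip: scaleR_2)
    with that S show ?thesis by (metis jordan_subalgebra_def)
  qed
  then have "X \<in> S"
    using D S' by (auto simp: X_def intro: subspace_sum)
  then obtain B l where B: "orthonormal B" "X = diag_op B l" "mat 1 = diag_op B (\<lambda>_. 1)"
    using S' symmetric_spectral by blast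
  \<comment> \<open>The form of \<open>X\<close> at \<open>x\<close> is the sum of the squared norms
    of the \<open>d *v x\<close>. If it vanishes, every \<open>d\<close> kills \<open>x\<close>, and
    so does their span.\<close>
  have ker: "Y *v x = 0" if "X *v x = 0" "Y \<in> S" for x Y
  proof -
    have "x \<bullet> (d ** d *v x) = (d *v x) \<bullet> (d *v x)" if "d \<in> D" for d
      using symmetric_matrices_inner[of d x "d *v x"] D S' that
      by (auto simp flip: matrix_vector_mul_assoc)
    then have "x \<bullet> (X *v x) = (\<Sum>d\<in>D. (d *v x) \<bullet> (d *v x))"
      by (simp add: X_def sum_matrix_vector_mult inner_sum_right)
    with that finD have "\<forall>d\<in>D. d *v x = 0"
      by (simp add: sum_nonneg_eq_0_iff)
    moreover have "subspace {Z. Z *v x = 0}"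
      by (auto simp: subspace_def matrix_vector_mult_add_rdistrib simp flip: scaleR_matrix_vector_assoc)
    ultimately have "span D \<subseteq> {Z. Z *v x = 0}"
      by (intro span_minimal) auto
    with D that show ?thesis by auto
  qed
  \<comment> \<open>The orthogonal projection onto the range of \<open>X\<close>. The range of
    \<open>mat 1 - E\<close> is then the kernel of \<open>X\<close>, which every \<open>Y\<close> in
    \<open>S\<close> kills by \<open>ker\<close>.\<close>
  define E where "E = diag_op B (\<lambda>b. if l b = 0 then 0 else 1)"
  have E: "E \<in> S"
    unfolding E_def using jordan_subalgebra_diag_op[OF S B(1), of l "\<lambda>t. if t = 0 then 0 else 1"]
      \<open>X \<in> S\<close> B by simp
  have "jordan_prod Y E = Y" if "Y \<in> S" for Y
  proof -
    have "X ** (mat 1 - E) = 0"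
    proof -
      have "X ** E = diag_op B l"
        unfolding B(2) E_def diag_op_mult[OF B(1)] by (rule diag_op_cong) simp
      then show ?thesis
        by (simp add: B(2) matrix_diff_ldistrib)
    qed
    then have "X *v ((mat 1 - E) *v x) = 0" for x
      by (simp add: matrix_vector_mul_assoc)
    then have "Y *v ((mat 1 - E) *v x) = 0" for x
      using ker that by blast
    then have "Y ** (mat 1 - E) = 0"
      by (simp add: matrix_eq matrix_vector_mul_assoc)
    then have YE: "Y ** E = Y"
      by (simp add: matrix_diff_ldistrib)
    have "transpose Y = Y" "transpose E = E"
      using that E S' by (auto simp: symmetric_matrices_def)
    then have "E ** Y = Y"
      using YE by (metis matrix_transpose_mul)
    with YE show ?thesis by (simp add: jordan_prod_def flip: scaleR_2)
  qed
  with E show ?thesis by (auto simp: has_jordan_unit_def)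
qed

section \<open>Positive unital projections\<close>

lemma matrix_add_rdistrib:
  fixes A B :: "real^'n^'m"
  shows "(A + B) ** C = A ** C + B ** C"
  by (simp add: matrix_matrix_mult_def vec_eq_iff algebra_simps sum.distrib)

text \<open>\<open>E\<close> is idempotent, so multiplying
  \<open>X ** E + E ** X = 2 *\<^sub>R X\<close> by \<open>E\<close> on the left and on the right
  identifies \<open>E ** X ** E\<close> with \<open>E ** X\<close> and with \<open>X ** E\<close>.
  Thus \<open>X\<close> and \<open>E\<close> commute.\<close>

lemma jordan_unit_mult:
  fixes E X :: "real^'n^'n"
  assumes E: "jordan_prod E E = E" and X: "jordan_prod X E = X"
  shows "E ** X = X" "X ** E = X"
proof -
  have EE: "E ** E = E"
    using E by (simp add: jordan_prod_def flip: scaleR_2)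
  have eq: "X ** E + E ** X = 2 *\<^sub>R X"
    using X by (simp add: jordan_prod_def) (metis scaleR_2 scaleR_half_double scaleR_right_distrib)
  have "E ** (X ** E) + E ** X = E ** X + E ** X"
    using arg_cong[OF eq, of "\<lambda>Z. E ** Z"]
    by (simp only: scaleR_2 matrix_add_ldistrib matrix_mul_assoc EE)
  then have "E ** (X ** E) = E ** X" by simp
  moreover have "X ** E + E ** (X ** E) = X ** E + X ** E"
    using arg_cong[OF eq, of "\<lambda>Z. Z ** E"]
    by (simp only: scaleR_2 matrix_add_rdistrib EE matrix_mul_assoc[symmetric])
  then have "E ** (X ** E) = X ** E" by simp
  ultimately show "E ** X = X" "X ** E = X"
    using eq by (simp_all flip: scaleR_2)
qed

lemma orth_proj_eqI:
  assumes "subspace S" "S \<subseteq> symmetric_matrices" "Y \<in> S" "\<And>Z. Z \<in> S \<Longrightarrow> X \<bullet> Z = Y \<bullet> Z"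
  shows "orth_proj S X = Y"
proof -
  let ?W = "orth_proj S X - Y"
  have W: "?W \<in> S"
    by (intro subspace_diff orth_proj_works assms)
  from assms(4)[OF W] inner_orth_proj[OF assms(1,2) W, of X] have "?W \<bullet> ?W = 0"
    by (simp add: inner_diff_left)
  then show ?thesis by simp
qed

lemma linear_orth_proj:
  assumes "subspace S" "S \<subseteq> symmetric_matrices"
  shows "linear (orth_proj S)"
proof (rule linearI)
  show "orth_proj S (X + Y) = orth_proj S X + orth_proj S Y" for X Y
    by (rule orth_proj_eqI) (simp_all add: subspace_add orth_proj_works assms inner_orth_proj inner_add_left)
  show "orth_proj S (c *\<^sub>R X) = c *\<^sub>R orth_proj S X" for c X
    by (rule orth_proj_eqI) (simp_all add: subspace_scale orth_proj_works assms inner_orth_proj)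
qed

text \<open>The inner product with \<open>mat 1\<close> is the trace, a sum of nonnegative
  eigenvalues. This turns equality of traces in Kadison's inequality into equality of
  matrices.\<close>

lemma psd_inner_mat_1_eq_0:
  assumes "A \<in> psd_cone" "A \<bullet> mat 1 = 0"
  shows "A = 0"
proof -
  obtain B l where B: "orthonormal B" "A = diag_op B l" "mat 1 = diag_op B (\<lambda>_. 1)"
    using symmetric_spectral[of A] assms(1) by (auto simp: psd_cone_def)
  have form: "b \<bullet> (A *v b) = l b" if "b \<in> B" for b
    using B that by (simp add: diag_op_mult_basis orthonormal_def)
  have "0 = A \<bullet> diag_op B (\<lambda>_. 1)"
    using assms(2) B(3) by simp
  also have "\<dots> = (\<Sum>b\<in>B. l b)"
    by (simp add: inner_diag_op form)
  finally have "(\<Sum>b\<in>B. l b) = 0" by simp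
  moreover have "0 \<le> l b" if "b \<in> B" for b
    using form[OF that] assms(1) by (auto simp: psd_cone_def dest: sym)
  ultimately have "\<forall>b\<in>B. l b = 0"
    using B(1) by (simp add: orthonormal_def sum_nonneg_eq_0_iff)
  with B(2) show ?thesis by (simp add: diag_op_def)
qed

lemma unital_positive_proj_square:
  fixes S :: "(real^'n^'n) set"
  assumes S: "subspace S" "S \<subseteq> symmetric_matrices"
    and pos: "positive_map (orth_proj S)" and "has_jordan_unit S" and X: "X \<in> S"
  shows "X ** X \<in> S"
proof -
  let ?P = "orth_proj S"
  obtain E where E: "E \<in> S" "\<And>Y. Y \<in> S \<Longrightarrow> jordan_prod Y E = Y"
    using assms(4) by (auto simp: has_jordan_unit_def)
  have EY: "E ** Y = Y" "Y ** E = Y" if "Y \<in> S" for Y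
    using jordan_unit_mult[of E Y] E that by auto
  have sym: "transpose Y = Y" if "Y \<in> S" for Y
    using that S by (auto simp: symmetric_matrices_def)
  have trace: "A \<bullet> mat 1 = trace A" for A :: "real^'n^'n"
    by (simp add: inner_vec_def mat_def trace_def if_distrib cong: if_cong)
  \<comment> \<open>Both sides are the trace of \<open>Y\<close>, because
    \<open>Y ** E = Y\<close>.\<close>
  have inner_E: "E \<bullet> Y = mat 1 \<bullet> Y" if "Y \<in> S" for Y
    using that S EY trace trace_inner_eq_inner[of Y E]
    by (auto simp: trace_inner_def inner_commute)
  have P1: "?P (mat 1) = E"
    using E inner_E by (intro orth_proj_eqI S) auto
  have PX: "?P X = X"
    using X by (intro orth_proj_eqI S) auto
  obtain B l where B: "orthonormal B" "X = diag_op B l" "mat 1 = diag_op B (\<lambda>_. 1)"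
    using S X symmetric_spectral by blast
  \<comment> \<open>Positivity makes each \<open>?P (outer b)\<close> positive semidefinite.
    \<open>Q\<close>, \<open>X\<close> and \<open>E\<close> are combinations of these same matrices
    with coefficients \<open>l b * l b\<close>, \<open>l b\<close> and \<open>1\<close>.\<close>
  have P_diag: "?P (diag_op B f) = (\<Sum>b\<in>B. f b *\<^sub>R ?P (outer b))" for f
    using linear_orth_proj[OF S] by (simp add: diag_op_def linear_sum linear_scale)
  define Q where "Q = ?P (X ** X)"
  have "X ** X = diag_op B (\<lambda>b. l b * l b)"
    by (simp add: B(2) diag_op_mult[OF B(1)])
  then have Q: "Q = (\<Sum>b\<in>B. (l b * l b) *\<^sub>R ?P (outer b))"
    by (simp add: Q_def P_diag)
  have XM: "X = (\<Sum>b\<in>B. l b *\<^sub>R ?P (outer b))"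
    using P_diag[of l] PX B(2) by simp
  have EM: "E = (\<Sum>b\<in>B. ?P (outer b))"
    using P_diag[of "\<lambda>_. 1"] P1 B(3) by simp
  have QS: "Q \<in> S" by (simp add: Q_def orth_proj_works S)
  have psd: "0 \<le> v \<bullet> ((Q - X ** X) *v v)" for v
  proof -
    have Xs: "v \<bullet> (X *v w) = (X *v v) \<bullet> w" for v w
      using symmetric_matrices_inner X S by blast
    \<comment> \<open>The block matrix with rows \<open>(Q, X)\<close> and \<open>(X, E)\<close> is positive semidefinite;
      evaluate it at \<open>(v, w)\<close> with \<open>w = - X v\<close>.\<close>
    define w where "w = - (X *v v)"
    have "0 \<le> (\<Sum>b\<in>B. (l b *\<^sub>R v + w) \<bullet> (?P (outer b) *v (l b *\<^sub>R v + w)))"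
      using pos outer_psd by (intro sum_nonneg) (auto simp: positive_map_def psd_cone_def)
    also have "\<dots> = v \<bullet> (Q *v v) + v \<bullet> (X *v w) + w \<bullet> (X *v v) + w \<bullet> (E *v w)"
      unfolding Q XM EM sum_matrix_vector_mult inner_sum_right sum.distrib[symmetric]
      by (rule sum.cong)
        (simp_all add: matrix_vector_right_distrib matrix_vector_mult_scaleR inner_add_left
          inner_add_right algebra_simps flip: scaleR_matrix_vector_assoc)
    also have "E *v w = w"
      using EY(1)[OF X] by (simp add: w_def linear_neg matrix_vector_mul_assoc)
    also have "v \<bullet> (Q *v v) + v \<bullet> (X *v w) + w \<bullet> (X *v v) + w \<bullet> w
        = v \<bullet> ((Q - X ** X) *v v)"
      by (simp add: Xs w_def matrix_vector_mult_diff_rdistrib inner_diff_right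
          flip: matrix_vector_mul_assoc)
    finally show ?thesis .
  qed
  have "transpose (Q - X ** X) = Q - X ** X"
    using sym[OF QS] sym[OF X] matrix_transpose_mul[of X X]
    by (simp add: transpose_def vec_eq_iff)
  with psd have "Q - X ** X \<in> psd_cone"
    by (simp add: psd_cone_def symmetric_matrices_def)
  \<comment> \<open>On \<open>Q\<close>, a member of \<open>S\<close>, \<open>mat 1\<close> may be
    replaced by \<open>E\<close>. Pairing with \<open>E\<close> does not see the projection, and
    \<open>X ** E = X\<close> then removes \<open>E\<close>.\<close>
  moreover have "(Q - X ** X) \<bullet> mat 1 = 0"
  proof -
    have "Q \<bullet> mat 1 = Q \<bullet> E"
      using inner_E[OF QS] by (simp add: inner_commute)
    also have "\<dots> = (X ** X) \<bullet> E"
      unfolding Q_def by (rule inner_orth_proj[OF S E(1)])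
    also have "\<dots> = trace (X ** X ** E)"
      using E S trace_inner_eq_inner[of E "X ** X"] by (auto simp: trace_inner_def)
    also have "\<dots> = (X ** X) \<bullet> mat 1"
      by (simp add: trace EY(2)[OF X] flip: matrix_mul_assoc)
    finally show ?thesis by (simp add: inner_diff_left)
  qed
  ultimately have "Q - X ** X = 0"
    by (rule psd_inner_mat_1_eq_0)
  with QS show ?thesis by simp
qed

lemma jordan_subalgebra_if_squares:
  fixes S :: "(real^'n^'n) set"
  assumes S: "subspace S" "S \<subseteq> symmetric_matrices" and sq: "\<And>X. X \<in> S \<Longrightarrow> X ** X \<in> S"
  shows "jordan_subalgebra S"
proof -
  have "jordan_prod X Y \<in> S" if "X \<in> S" "Y \<in> S" for X Y
  proof -
    have "jordan_prod X Y = (1/2) *\<^sub>R ((X + Y) ** (X + Y) - X ** X - Y ** Y)"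
      by (simp add: jordan_prod_def matrix_add_ldistrib matrix_add_rdistrib)
    also have "\<dots> \<in> S"
      using that by (intro subspace_scale subspace_diff subspace_add sq S)
    finally show ?thesis .
  qed
  with S show ?thesis by (simp add: jordan_subalgebra_def)
qed

theorem theorem2p1:
  fixes S :: "(real^'n^'n) set"
  assumes "subspace S" and "S \<subseteq> symmetric_matrices"
  shows "positive_map (orth_proj S) \<and> has_jordan_unit S \<longleftrightarrow> jordan_subalgebra S"
  using unital_positive_proj_square[OF assms] jordan_subalgebra_if_squares[OF assms]
    jordan_subalgebra_positive_map jordan_subalgebra_unit
  by blast

end
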